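(* Let $\lambda$ be a partition. Then $$g_\lambda(x_1,x_2,\dots)=\sum_\mu f_\lambda^\mu\,s_\mu(x_1,x_2,\dots),$$ where the sum is over partitions $\mu$ and $s_\mu$ is the Schur function.
   Context: Young diagrams are drawn in English notation. A reverse plane partition $T$ of shape $\lambda$ is a filling of the boxes of $\lambda$ with positive integers weakly increasing along rows and down columns. Define $x^T=\prod_{i\ge1}x_i^{T(i)}$, where $T(i)$ is the number of columns of $T$ containing one or more entries equal to $i$. The dual stable Grothendieck polynomial is $g_\lambda(x_1,x_2,\dots)=\sum_T x^T$ over all reverse plane partitions $T$ of shape $\lambda$. For partitions $\lambda,\mu$: if $\mu\not\subseteq\lambda$ set $f_\lambda^\mu=0$. Otherwise $f_\lambda^\mu$ is the number of elegant fillings of the skew shape $\lambda/\mu$, i.e. fillings of its boxes with positive integers that (1) are semistandard (weakly increasing along rows, strictly increasing down columns) and (2) have all numbers in row $i$ lying in $[1,i-1]$. In particular there is none if $\lambda/\mu$ has a box in the first row, and $f_\lambda^\lambda=1$ (the empty filling). *)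

theory Defs
  imports Main "HOL-Library.FuncSet" "HOL-Library.Poly_Mapping"
begin

typedef partition = "{p :: nat list. sorted_wrt (\<ge>) p \<and> 0 \<notin> set p}"
  morphisms parts Partition
  by (rule exI[of _ "[]"]) simp

text \<open>
  Boxes are pairs \<open>(row, column)\<close>, in English notation and counted from 1, so
  \<open>parts lam ! (i - 1)\<close> is the length of row \<open>i\<close>.
\<close>

definition diagram :: "partition \<Rightarrow> (nat \<times> nat) set" where
  "diagram lam = {(i, j). i \<in> {1..length (parts lam)} \<and> j \<in> {1..parts lam ! (i - 1)}}"

definition row_weak :: "(nat \<times> nat) set \<Rightarrow> (nat \<times> nat \<Rightarrow> nat) \<Rightarrow> bool" where
  "row_weak D T \<longleftrightarrow> (\<forall>i j j'. (i, j) \<in> D \<longrightarrow> (i, j') \<in> D \<longrightarrow> j \<le> j' \<longrightarrow> T (i, j) \<le> T (i, j'))"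

definition col_weak :: "(nat \<times> nat) set \<Rightarrow> (nat \<times> nat \<Rightarrow> nat) \<Rightarrow> bool" where
  "col_weak D T \<longleftrightarrow> (\<forall>i i' j. (i, j) \<in> D \<longrightarrow> (i', j) \<in> D \<longrightarrow> i \<le> i' \<longrightarrow> T (i, j) \<le> T (i', j))"

definition col_strict :: "(nat \<times> nat) set \<Rightarrow> (nat \<times> nat \<Rightarrow> nat) \<Rightarrow> bool" where
  "col_strict D T \<longleftrightarrow> (\<forall>i i' j. (i, j) \<in> D \<longrightarrow> (i', j) \<in> D \<longrightarrow> i < i' \<longrightarrow> T (i, j) < T (i', j))"

definition rpps :: "partition \<Rightarrow> (nat \<times> nat \<Rightarrow> nat) set" where
  "rpps lam = {T \<in> diagram lam \<rightarrow>\<^sub>E {1..}. row_weak (diagram lam) T \<and> col_weak (diagram lam) T}"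

definition semistandard :: "(nat \<times> nat) set \<Rightarrow> (nat \<times> nat \<Rightarrow> nat) set" where
  "semistandard D = {T \<in> D \<rightarrow>\<^sub>E {1..}. row_weak D T \<and> col_strict D T}"

text \<open>
  A monomial in \<open>x\<^sub>1, x\<^sub>2, \<dots>\<close> is given by its finitely supported exponent vector (so
  \<open>+\<close> on exponents is multiplication of monomials and \<open>Poly_Mapping.single i k\<close> is
  \<open>x\<^sub>i ^ k\<close>), and a formal power series by its coefficient function.
\<close>

type_synonym power_series = "(nat \<Rightarrow>\<^sub>0 nat) \<Rightarrow> int"

text \<open>
  The series \<open>\<Sum>T\<in>A. x ^ w T\<close>. It is used only where each exponent vector is attained finitely
  often; see \<open>finite_rpps_weight\<close> and \<open>finite_semistandard_weight\<close> below.
\<close>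

definition gen_series :: "'t set \<Rightarrow> ('t \<Rightarrow> (nat \<Rightarrow>\<^sub>0 nat)) \<Rightarrow> power_series" where
  "gen_series A w = (\<lambda>m. int (card {T \<in> A. w T = m}))"

definition num_columns :: "(nat \<times> nat) set \<Rightarrow> (nat \<times> nat \<Rightarrow> nat) \<Rightarrow> nat \<Rightarrow> nat" where
  "num_columns D T k = card {j. \<exists>i. (i, j) \<in> D \<and> T (i, j) = k}"

definition column_weight :: "(nat \<times> nat) set \<Rightarrow> (nat \<times> nat \<Rightarrow> nat) \<Rightarrow> (nat \<Rightarrow>\<^sub>0 nat)" where
  "column_weight D T = (\<Sum>k\<in>T ` D. Poly_Mapping.single k (num_columns D T k))"

definition box_weight :: "(nat \<times> nat) set \<Rightarrow> (nat \<times> nat \<Rightarrow> nat) \<Rightarrow> (nat \<Rightarrow>\<^sub>0 nat)" where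
  "box_weight D T = (\<Sum>b\<in>D. Poly_Mapping.single (T b) 1)"

definition dual_grothendieck :: "partition \<Rightarrow> power_series" where
  "dual_grothendieck lam = gen_series (rpps lam) (column_weight (diagram lam))"

definition schur :: "partition \<Rightarrow> power_series" where
  "schur mu = gen_series (semistandard (diagram mu)) (box_weight (diagram mu))"

definition elegant_fillings :: "partition \<Rightarrow> partition \<Rightarrow> (nat \<times> nat \<Rightarrow> nat) set" where
  "elegant_fillings lam mu =
    {T \<in> semistandard (diagram lam - diagram mu).
      \<forall>(i, j) \<in> diagram lam - diagram mu. T (i, j) \<in> {1..i - 1}}"

definition elegant_number :: "partition \<Rightarrow> partition \<Rightarrow> nat" where
  "elegant_number lam mu =
    (if diagram mu \<subseteq> diagram lam then card (elegant_fillings lam mu) else 0)"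

text \<open>
  The remaining facts show that no cardinality or sum above takes its default value for infinite
  sets, and that in a sum of multiples of \<open>elegant_number lam mu\<close> over all partitions
  \<open>mu\<close> only finitely many terms are nonzero.
\<close>

lemma finite_diagram: "finite (diagram lam)"
proof -
  have "diagram lam = (SIGMA i:{1..length (parts lam)}. {1..parts lam ! (i - 1)})"
    by (auto simp: diagram_def)
  then show ?thesis by simp
qed

lemma lookup_column_weight:
  assumes "finite D"
  shows "Poly_Mapping.lookup (column_weight D T) k = num_columns D T k"
proof -
  have "num_columns D T k = 0" if "k \<notin> T ` D"
  proof -
    have "{j. \<exists>i. (i, j) \<in> D \<and> T (i, j) = k} = {}" using that by force
    then show ?thesis unfolding num_columns_def by (simp only: card.empty)
  qed
  moreover have "Poly_Mapping.lookup (column_weight D T) k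
      = (if k \<in> T ` D then num_columns D T k else 0)"
    using assms by (simp add: column_weight_def lookup_sum lookup_single when_def sum.delta)
  ultimately show ?thesis by auto
qed

lemma lookup_box_weight:
  assumes "finite D"
  shows "Poly_Mapping.lookup (box_weight D T) k = card {b \<in> D. T b = k}"
  using assms
  by (simp add: box_weight_def lookup_sum lookup_single when_def sum.If_cases Int_def)

lemma finite_fillings_keys:
  assumes "finite D"
  shows "finite {T \<in> D \<rightarrow>\<^sub>E {1..}. T ` D \<subseteq> Poly_Mapping.keys m}"
proof (rule finite_subset)
  show "{T \<in> D \<rightarrow>\<^sub>E {1..}. T ` D \<subseteq> Poly_Mapping.keys m} \<subseteq> D \<rightarrow>\<^sub>E Poly_Mapping.keys m"
    by (auto simp: PiE_def)
  show "finite (D \<rightarrow>\<^sub>E Poly_Mapping.keys m)"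
    using assms by (intro finite_PiE) auto
qed

lemma finite_rpps_weight: "finite {T \<in> rpps lam. column_weight (diagram lam) T = m}"
proof -
  have "T (i, j) \<in> Poly_Mapping.keys (column_weight (diagram lam) T)"
    if "(i, j) \<in> diagram lam" for T i j
  proof -
    have "finite {j'. \<exists>i'. (i', j') \<in> diagram lam \<and> T (i', j') = T (i, j)}"
      by (rule finite_subset[of _ "snd ` diagram lam"]) (force simp: finite_diagram)+
    moreover have "j \<in> {j'. \<exists>i'. (i', j') \<in> diagram lam \<and> T (i', j') = T (i, j)}"
      using that by blast
    ultimately have "num_columns (diagram lam) T (T (i, j)) \<noteq> 0"
      unfolding num_columns_def using card_gt_0_iff by blast
    then show ?thesis
      by (simp add: in_keys_iff lookup_column_weight finite_diagram)
  qed
  then have "{T \<in> rpps lam. column_weight (diagram lam) T = m}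
      \<subseteq> {T \<in> diagram lam \<rightarrow>\<^sub>E {1..}. T ` diagram lam \<subseteq> Poly_Mapping.keys m}"
    by (force simp only: rpps_def mem_Collect_eq)
  then show ?thesis
    by (rule finite_subset) (rule finite_fillings_keys[OF finite_diagram])
qed

lemma finite_semistandard_weight:
  "finite {T \<in> semistandard (diagram mu). box_weight (diagram mu) T = m}"
proof -
  have "T b \<in> Poly_Mapping.keys (box_weight (diagram mu) T)" if "b \<in> diagram mu" for T b
  proof -
    have "card {c \<in> diagram mu. T c = T b} \<noteq> 0"
      using that finite_diagram[of mu] by (cases b) auto
    then show ?thesis
      by (simp add: in_keys_iff lookup_box_weight finite_diagram)
  qed
  then have "{T \<in> semistandard (diagram mu). box_weight (diagram mu) T = m}
      \<subseteq> {T \<in> diagram mu \<rightarrow>\<^sub>E {1..}. T ` diagram mu \<subseteq> Poly_Mapping.keys m}"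
    by (force simp only: semistandard_def mem_Collect_eq)
  then show ?thesis
    by (rule finite_subset) (rule finite_fillings_keys[OF finite_diagram])
qed

lemma finite_elegant_fillings: "finite (elegant_fillings lam mu)"
proof (rule finite_subset)
  let ?D = "diagram lam - diagram mu"
  show "elegant_fillings lam mu \<subseteq> (\<Pi>\<^sub>E b\<in>?D. {1..fst b - 1})"
  proof
    fix T assume "T \<in> elegant_fillings lam mu"
    then have T: "T \<in> ?D \<rightarrow>\<^sub>E {1..}" "\<And>i j. (i, j) \<in> ?D \<Longrightarrow> T (i, j) \<in> {1..i - 1}"
      unfolding elegant_fillings_def semistandard_def by blast+
    show "T \<in> (\<Pi>\<^sub>E b\<in>?D. {1..fst b - 1})"
    proof (rule PiE_I)
      show "T b \<in> {1..fst b - 1}" if "b \<in> ?D" for b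
        using T(2)[of "fst b" "snd b"] that by (simp only: prod.collapse)
      show "T b = undefined" if "b \<notin> ?D" for b
        using PiE_arb[OF T(1) that] .
    qed
  qed
  show "finite (\<Pi>\<^sub>E b\<in>?D. {1..fst b - 1})"
    by (intro finite_PiE) (auto simp: finite_diagram)
qed

lemma diagram_inject: "diagram lam = diagram mu \<longleftrightarrow> lam = mu"
proof
  have pos: "0 < parts \<nu> ! k" if "k < length (parts \<nu>)" for \<nu> k
    using parts[of \<nu>] that by (metis (mono_tags, lifting) gr0I mem_Collect_eq nth_mem)
  have len: "k < length (parts \<nu>) \<longleftrightarrow> (Suc k, 1) \<in> diagram \<nu>" for \<nu> k
    using pos[of k \<nu>] by (auto simp: diagram_def)
  have row: "parts \<nu> ! k = card {j. (Suc k, j) \<in> diagram \<nu>}" if "k < length (parts \<nu>)" for \<nu> k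
  proof -
    have "{j. (Suc k, j) \<in> diagram \<nu>} = {1..parts \<nu> ! k}"
      using that by (auto simp: diagram_def)
    then show ?thesis by simp
  qed
  assume eq: "diagram lam = diagram mu"
  then have "k < length (parts lam) \<longleftrightarrow> k < length (parts mu)" for k
    by (simp add: len)
  then have "length (parts lam) = length (parts mu)"
    by (meson linorder_less_linear less_irrefl)
  then have "parts lam = parts mu"
    using eq row by (intro nth_equalityI) simp_all
  then show "lam = mu" by (simp add: parts_inject)
qed simp

lemma finite_elegant_number: "finite {mu. elegant_number lam mu \<noteq> 0}"
proof (rule finite_subset)
  show "{mu. elegant_number lam mu \<noteq> 0} \<subseteq> diagram -` Pow (diagram lam)"
    by (auto simp: elegant_number_def split: if_splits)
  show "finite (diagram -` Pow (diagram lam))"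
    by (rule finite_vimageI) (auto simp: finite_diagram inj_def diagram_inject)
qed

end

theory Submission
  imports Defs
begin

text \<open>
  A filling with entries at most \<open>n\<close> is a chain of partitions whose steps are its level sets, so
  all three kinds of fillings are counted by products of matrices indexed by partitions. Let
  \<open>H k\<close> be the matrix of horizontal strips in rows below the \<open>k\<close>-th; elegant fillings are
  counted by \<open>F t = H t \<cdots> H 1\<close> for large \<open>t\<close>. Let \<open>S t\<close> be the matrix of skew shapes with
  \<open>c\<close> nonempty columns in which a column may contain several boxes only if they lie in rows
  \<open>1, \<dots>, t + 1\<close>. An intermediate partition in either side of \<open>S (t + 1) H (t + 1) = H (t + 1) S t\<close>
  has rows that range independently over the same intervals, and reflecting these intervals proves
  the identity. Hence \<open>S t F t = F t S 0\<close>: adding one variable to a dual stable Grothendieck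
  polynomial corresponds under \<open>F\<close> to adding one variable to Schur functions, and the theorem
  follows by induction on the number of variables.
\<close>

section \<open>Partitions as row-length functions and as order ideals of boxes\<close>

text \<open>
  Rows are counted from 0 in \<open>row_len\<close>, so row \<open>i\<close> here is row \<open>i + 1\<close> of the diagram.
\<close>
definition row_len :: "partition \<Rightarrow> nat \<Rightarrow> nat" where
  "row_len p i = (if i < length (parts p) then parts p ! i else 0)"

lemma mem_diagram: "(i, j) \<in> diagram p \<longleftrightarrow> 1 \<le> i \<and> 1 \<le> j \<and> j \<le> row_len p (i - 1)"
  by (auto simp: diagram_def row_len_def)

lemma row_len_antimono: "i \<le> i' \<Longrightarrow> row_len p i' \<le> row_len p i"
  using parts[of p] by (auto simp: row_len_def sorted_wrt_iff_nth_less nat_less_le)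

lemma row_len_eq_0: "length (parts p) \<le> i \<Longrightarrow> row_len p i = 0"
  by (simp add: row_len_def)

lemma diagram_subset_iff: "diagram p \<subseteq> diagram q \<longleftrightarrow> (\<forall>i. row_len p i \<le> row_len q i)"
proof
  assume sub: "diagram p \<subseteq> diagram q"
  show "\<forall>i. row_len p i \<le> row_len q i"
  proof
    fix i
    show "row_len p i \<le> row_len q i"
    proof (cases "row_len p i = 0")
      case False
      then have "(Suc i, row_len p i) \<in> diagram p" by (simp add: mem_diagram)
      with sub have "(Suc i, row_len p i) \<in> diagram q" by blast
      then show ?thesis by (simp add: mem_diagram)
    qed simp
  qed
next
  assume "\<forall>i. row_len p i \<le> row_len q i"
  then show "diagram p \<subseteq> diagram q"
    by (intro subrelI) (simp add: mem_diagram, meson le_trans)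
qed

lemma row_len_inject: "row_len p = row_len q \<longleftrightarrow> p = q"
proof
  assume "row_len p = row_len q"
  then have "diagram p = diagram q" by (intro set_eqI) (auto simp: mem_diagram)
  then show "p = q" by (simp add: diagram_inject)
qed simp

lemma ex_partition_row_len:
  assumes "antimono f" and "\<And>i. N \<le> i \<Longrightarrow> f i = 0"
  shows "\<exists>p. row_len p = f"
proof -
  \<comment> \<open>A partition lists only nonzero parts, so the list is cut at the first zero of
    \<open>f\<close>; antitonicity makes all later values zero.\<close>
  define n where "n = (LEAST n. f n = 0)"
  have n0: "f n = 0" unfolding n_def using assms(2)[of N] by (metis (mono_tags) LeastI order_refl)
  have pos: "f i \<noteq> 0" if "i < n" for i using that unfolding n_def by (rule not_less_Least)
  have zero: "f i = 0" if "n \<le> i" for i using antimonoD[OF assms(1) that] n0 by simp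
  have "map f [0..<n] \<in> {p. sorted_wrt (\<ge>) p \<and> 0 \<notin> set p}"
  proof (intro CollectI conjI)
    show "sorted_wrt (\<ge>) (map f [0..<n])"
      unfolding sorted_wrt_iff_nth_less
    proof (intro allI impI)
      fix i j assume "i < j" "j < length (map f [0..<n])"
      then show "map f [0..<n] ! j \<le> map f [0..<n] ! i"
        using antimonoD[OF assms(1), of i j] by simp
    qed
    show "0 \<notin> set (map f [0..<n])"
    proof
      assume "0 \<in> set (map f [0..<n])"
      then obtain i where "i < n" "f i = 0" by auto
      with pos show False by blast
    qed
  qed
  then have "parts (Partition (map f [0..<n])) = map f [0..<n]" by (rule Partition_inverse)
  then have "row_len (Partition (map f [0..<n])) = f"
    by (intro ext) (simp add: row_len_def zero)
  then show ?thesis by blast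
qed

lemma diagram_downward:
  assumes "(i, j) \<in> diagram p" "1 \<le> i'" "i' \<le> i" "1 \<le> j'" "j' \<le> j"
  shows "(i', j') \<in> diagram p"
proof -
  have "j \<le> row_len p (i - 1)" using assms(1) by (simp add: mem_diagram)
  also have "\<dots> \<le> row_len p (i' - 1)" using assms(3) by (intro row_len_antimono) simp
  finally show ?thesis using assms by (simp add: mem_diagram)
qed

text \<open>Closure towards the corner makes each row an initial interval and the row lengths weakly
  decreasing. The partitions of a chain arise in this way from the level sets of a filling.\<close>

lemma ex_partition_diagram:
  assumes fin: "finite D"
    and pos: "\<And>i j. (i, j) \<in> D \<Longrightarrow> 1 \<le> i \<and> 1 \<le> j"
    and down: "\<And>i j i' j'. (i, j) \<in> D \<Longrightarrow> 1 \<le> i' \<Longrightarrow> i' \<le> i \<Longrightarrow> 1 \<le> j' \<Longrightarrow> j' \<le> j \<Longrightarrow> (i', j') \<in> D"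
  shows "\<exists>p. diagram p = D"
proof -
  define R where "R i = {j. (Suc i, j) \<in> D}" for i
  define f where "f i = card (R i)" for i
  have finR: "finite (R i)" for i
    by (rule finite_subset[of _ "snd ` D"]) (force simp: R_def fin)+
  have R: "R i = {1..f i}" for i
  proof (cases "R i = {}")
    case False
    have "R i = {1..Max (R i)}"
    proof (intro set_eqI iffI)
      fix j assume "j \<in> {1..Max (R i)}"
      then show "j \<in> R i"
        using Max_in[OF finR False] down[of "Suc i" "Max (R i)" "Suc i" j] by (simp add: R_def)
    qed (use pos Max_ge[OF finR] in \<open>auto simp: R_def\<close>)
    then show ?thesis unfolding f_def by (metis card_atLeastAtMost diff_Suc_1)
  qed (simp add: f_def)
  have "antimono f"
    unfolding f_def
  proof (intro antimonoI card_mono finR)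
    fix a b :: nat assume "a \<le> b"
    then show "R b \<subseteq> R a" using pos down[of "Suc b" _ "Suc a"] by (force simp: R_def)
  qed
  \<comment> \<open>For empty \<open>D\<close> this \<open>Max\<close> is unspecified, but it is
    compared only with the row of a box assumed to lie in \<open>D\<close>.\<close>
  moreover have "f i = 0" if "Suc (Max (fst ` D)) \<le> i" for i
  proof -
    have "(Suc i, j) \<notin> D" for j
    proof
      assume "(Suc i, j) \<in> D"
      then have "Suc i \<le> Max (fst ` D)" using fin by (intro Max_ge) force+
      with that show False by simp
    qed
    then show ?thesis by (simp add: f_def R_def)
  qed
  ultimately obtain p where p: "row_len p = f" using ex_partition_row_len by blast
  have "(i, j) \<in> diagram p \<longleftrightarrow> (i, j) \<in> D" for i j
  proof (cases i)
    case 0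
    then show ?thesis using pos[of 0 j] by (auto simp: mem_diagram)
  next
    case (Suc i')
    have "(i, j) \<in> D \<longleftrightarrow> j \<in> R i'" using Suc by (simp add: R_def)
    also have "\<dots> \<longleftrightarrow> (i, j) \<in> diagram p" unfolding R by (auto simp: Suc mem_diagram p)
    finally show ?thesis by simp
  qed
  then have "diagram p = D" by auto
  then show ?thesis ..
qed

text \<open>A finite index set for the matrices: it is closed under removing strips, so the products
  are finite sums over it.\<close>

definition subparts :: "partition \<Rightarrow> partition set" where
  "subparts p = {q. diagram q \<subseteq> diagram p}"

lemma finite_subparts: "finite (subparts p)"
proof -
  have "finite (diagram -` Pow (diagram p))"
    by (rule finite_vimageI) (auto simp: finite_diagram inj_def diagram_inject)
  then show ?thesis by (simp add: subparts_def vimage_def)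
qed

section \<open>Removing the largest entry of a filling\<close>

text \<open>The three kinds of fillings differ only in the condition \<open>Q k\<close> on the level
  set of \<open>k\<close>; strictness of columns is such a condition too. Containment is built in so
  that the count is zero for all other pairs of shapes.\<close>

definition fillings ::
  "(nat \<Rightarrow> (nat \<times> nat) set \<Rightarrow> bool) \<Rightarrow> nat \<Rightarrow> partition \<Rightarrow> partition \<Rightarrow> (nat \<times> nat \<Rightarrow> nat) set" where
  "fillings Q n lam mu =
    {T \<in> (diagram lam - diagram mu) \<rightarrow>\<^sub>E {1..n}. diagram mu \<subseteq> diagram lam
      \<and> row_weak (diagram lam - diagram mu) T \<and> col_weak (diagram lam - diagram mu) T
      \<and> (\<forall>k \<in> {1..n}. Q k {b \<in> diagram lam - diagram mu. T b = k})}"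

lemma finite_fillings: "finite (fillings Q n lam mu)"
  by (rule finite_subset[of _ "(diagram lam - diagram mu) \<rightarrow>\<^sub>E {1..n}"])
    (auto simp: fillings_def finite_diagram intro!: finite_PiE)

lemma card_fillings_0: "card (fillings Q 0 lam mu) = of_bool (lam = mu)"
proof (cases "lam = mu")
  case True
  then have "fillings Q 0 lam mu = {\<lambda>_. undefined}"
    by (auto simp: fillings_def row_weak_def col_weak_def)
  then show ?thesis using True by simp
next
  case False
  then have "diagram lam \<noteq> diagram mu" by (simp add: diagram_inject)
  then have "fillings Q 0 lam mu = {}" by (auto simp: fillings_def)
  then show ?thesis using False by simp
qed

text \<open>Since entries weakly increase, the boxes with entry at most \<open>n\<close> together
  with \<open>mu\<close> form an order ideal, hence a diagram.\<close>

lemma fillings_restrict: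
  assumes T: "T \<in> fillings Q (Suc n) lam mu"
  obtains kap where "diagram kap = diagram mu \<union> {b \<in> diagram lam - diagram mu. T b \<le> n}"
    "diagram kap \<subseteq> diagram lam" "Q (Suc n) (diagram lam - diagram kap)"
    "restrict T (diagram kap - diagram mu) \<in> fillings Q n kap mu"
proof -
  let ?D = "diagram lam - diagram mu"
  let ?K = "diagram mu \<union> {b \<in> ?D. T b \<le> n}"
  have TE: "T \<in> ?D \<rightarrow>\<^sub>E {1..Suc n}" and sub: "diagram mu \<subseteq> diagram lam"
    and row: "row_weak ?D T" and col: "col_weak ?D T"
    and lev: "\<And>k. k \<in> {1..Suc n} \<Longrightarrow> Q k {b \<in> ?D. T b = k}"
    using T by (auto simp: fillings_def)
  have rng: "T b \<in> {1..Suc n}" if "b \<in> ?D" for b using TE that by (rule PiE_mem)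
  have "\<exists>p. diagram p = ?K"
  proof (rule ex_partition_diagram)
    show "finite ?K" by (simp add: finite_diagram)
    show "1 \<le> i \<and> 1 \<le> j" if "(i, j) \<in> ?K" for i j
      using that by (auto simp: mem_diagram)
    fix i j i' j'
    assume K: "(i, j) \<in> ?K" and le: "1 \<le> i'" "i' \<le> i" "1 \<le> j'" "j' \<le> j"
    show "(i', j') \<in> ?K"
    proof (cases "(i', j') \<in> diagram mu")
      case False
      \<comment> \<open>With \<open>(i', j')\<close> the box \<open>(i', j)\<close> is also outside
        \<open>mu\<close>, so \<open>T (i', j')\<close> and \<open>T (i, j)\<close> can be compared
        through it without leaving the skew shape.\<close>
      then have nmu: "(i, j) \<notin> diagram mu" "(i', j) \<notin> diagram mu"
        using diagram_downward[of i j mu i' j'] diagram_downward[of i' j mu i' j'] le by auto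
      then have D: "(i, j) \<in> ?D" "T (i, j) \<le> n" using K by auto
      then have D': "(i', j) \<in> ?D" "(i', j') \<in> ?D"
        using le nmu False diagram_downward[of i j lam i' j] diagram_downward[of i j lam i' j']
        by (auto simp: mem_diagram)
      have "T (i', j') \<le> T (i', j)" using row D' le by (simp add: row_weak_def)
      also have "\<dots> \<le> T (i, j)" using col D D' le by (simp add: col_weak_def)
      finally show ?thesis using D D' by simp
    qed simp
  qed
  then obtain kap where kap: "diagram kap = ?K" ..
  have kl: "diagram kap \<subseteq> diagram lam" using kap sub by auto
  have top: "diagram lam - diagram kap = {b \<in> ?D. T b = Suc n}"
    unfolding kap using rng by (fastforce simp: le_Suc_eq)
  have KD: "diagram kap - diagram mu = {b \<in> ?D. T b \<le> n}" using kap by auto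
  have "{b \<in> {b \<in> ?D. T b \<le> n}. restrict T {b \<in> ?D. T b \<le> n} b = k} = {b \<in> ?D. T b = k}"
    if "k \<in> {1..n}" for k using that by auto
  then have "restrict T (diagram kap - diagram mu) \<in> fillings Q n kap mu"
    using row col lev rng unfolding fillings_def KD
    by (auto simp: row_weak_def col_weak_def kap)
  moreover have "Q (Suc n) (diagram lam - diagram kap)" unfolding top by (rule lev) simp
  ultimately show ?thesis using that kap kl by blast
qed

text \<open>Inverse of \<open>fillings_restrict\<close>: the last two conclusions recover
  \<open>kap\<close> and \<open>T\<close> from \<open>U\<close>. An equation fixes \<open>U\<close>,
  so that one filling can be presented by two pairs, as the proof of injectivity requires.\<close>

lemma fillings_extend:
  assumes T: "T \<in> fillings Q n kap mu" and kl: "diagram kap \<subseteq> diagram lam"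
    and top: "Q (Suc n) (diagram lam - diagram kap)"
    and U_def: "U = (\<lambda>b. if b \<in> diagram lam - diagram kap then Suc n else T b)"
  shows "U \<in> fillings Q (Suc n) lam mu"
    and "diagram mu \<union> {b \<in> diagram lam - diagram mu. U b \<le> n} = diagram kap"
    and "restrict U (diagram kap - diagram mu) = T"
proof -
  let ?D = "diagram lam - diagram mu" and ?E = "diagram kap - diagram mu"
  have TE: "T \<in> ?E \<rightarrow>\<^sub>E {1..n}" and sub: "diagram mu \<subseteq> diagram kap"
    and row: "row_weak ?E T" and col: "col_weak ?E T"
    and lev: "\<And>k. k \<in> {1..n} \<Longrightarrow> Q k {b \<in> ?E. T b = k}"
    using T by (auto simp: fillings_def)
  have rng: "1 \<le> T b \<and> T b \<le> n" if "b \<in> ?E" for b using PiE_mem[OF TE that] by simp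
  have arb: "T b = undefined" if "b \<notin> ?E" for b using TE that by (rule PiE_arb)
  show "diagram mu \<union> {b \<in> ?D. U b \<le> n} = diagram kap"
    using sub kl rng by (auto simp: U_def)
  show "restrict U ?E = T" by (rule ext) (auto simp: U_def restrict_def arb)
  have UE: "U \<in> ?D \<rightarrow>\<^sub>E {1..Suc n}"
  proof (rule PiE_I)
    show "U b \<in> {1..Suc n}" if "b \<in> ?D" for b
      using rng[of b] that by (auto simp: U_def)
    show "U b = undefined" if "b \<notin> ?D" for b
      using arb[of b] that sub kl by (auto simp: U_def)
  qed
  have Ule: "U b \<le> Suc n" if "b \<in> ?D" for b using PiE_mem[OF UE that] by simp
  have "row_weak ?D U"
    unfolding row_weak_def
  proof (intro allI impI)
    fix i j j' assume D: "(i, j) \<in> ?D" "(i, j') \<in> ?D" "j \<le> j'"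
    show "U (i, j) \<le> U (i, j')"
    proof (cases "(i, j') \<in> diagram kap")
      case True
      moreover have "(i, j) \<in> diagram kap"
        using diagram_downward[OF True, of i j] D by (simp add: mem_diagram)
      ultimately show ?thesis using row D by (auto simp: U_def row_weak_def)
    next
      case False
      then show ?thesis using D Ule[OF D(1)] by (simp add: U_def)
    qed
  qed
  moreover have "col_weak ?D U"
    unfolding col_weak_def
  proof (intro allI impI)
    fix i i' j assume D: "(i, j) \<in> ?D" "(i', j) \<in> ?D" "i \<le> i'"
    show "U (i, j) \<le> U (i', j)"
    proof (cases "(i', j) \<in> diagram kap")
      case True
      moreover have "(i, j) \<in> diagram kap"
        using diagram_downward[OF True, of i j] D by (simp add: mem_diagram)
      ultimately show ?thesis using col D by (auto simp: U_def col_weak_def)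
    next
      case False
      then show ?thesis using D Ule[OF D(1)] by (simp add: U_def)
    qed
  qed
  moreover have "Q k {b \<in> ?D. U b = k}" if "k \<in> {1..Suc n}" for k
  proof (cases "k = Suc n")
    case True
    have "{b \<in> ?D. U b = k} = diagram lam - diagram kap"
      unfolding True using sub kl rng by (force simp: U_def)
    then show ?thesis using top True by simp
  next
    case False
    have "{b \<in> ?D. U b = k} = {b \<in> ?E. T b = k}"
      using False kl by (auto simp: U_def)
    then show ?thesis using lev that False by simp
  qed
  ultimately show "U \<in> fillings Q (Suc n) lam mu"
    using UE sub kl by (simp add: fillings_def)
qed

definition strip :: "((nat \<times> nat) set \<Rightarrow> bool) \<Rightarrow> partition \<Rightarrow> partition \<Rightarrow> bool" where
  "strip P lam mu \<longleftrightarrow> diagram mu \<subseteq> diagram lam \<and> P (diagram lam - diagram mu)"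

text \<open>The largest level is one strip and the rest is a filling with fewer entries, so the
  counts are products of 0/1 matrices with the largest level as leftmost factor.\<close>

lemma card_fillings_Suc:
  "card (fillings Q (Suc n) lam mu) =
    (\<Sum>kap | strip (Q (Suc n)) lam kap. card (fillings Q n kap mu))"
proof -
  let ?K = "{kap. strip (Q (Suc n)) lam kap}"
  let ?g = "\<lambda>(kap, T) b. if b \<in> diagram lam - diagram kap then Suc n else T b"
  have finK: "finite ?K"
    by (rule finite_subset[OF _ finite_subparts[of lam]]) (auto simp: strip_def subparts_def)
  have "bij_betw ?g (SIGMA kap:?K. fillings Q n kap mu) (fillings Q (Suc n) lam mu)"
    unfolding bij_betw_def
  proof (intro conjI inj_onI set_eqI iffI)
    fix x y
    assume x: "x \<in> (SIGMA kap:?K. fillings Q n kap mu)"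
      and y: "y \<in> (SIGMA kap:?K. fillings Q n kap mu)" and eq: "?g x = ?g y"
    obtain kx Tx ky Ty where xy: "x = (kx, Tx)" "y = (ky, Ty)" by fastforce
    have Tx: "Tx \<in> fillings Q n kx mu" and Ty: "Ty \<in> fillings Q n ky mu"
      and kx: "diagram kx \<subseteq> diagram lam" "Q (Suc n) (diagram lam - diagram kx)"
      and ky: "diagram ky \<subseteq> diagram lam" "Q (Suc n) (diagram lam - diagram ky)"
      using x y xy by (auto simp: strip_def)
    have eqx: "?g y = (\<lambda>b. if b \<in> diagram lam - diagram kx then Suc n else Tx b)"
      using eq unfolding xy by simp
    have eqy: "?g y = (\<lambda>b. if b \<in> diagram lam - diagram ky then Suc n else Ty b)"
      unfolding xy by simp
    have "kx = ky"
      using fillings_extend(2)[OF Tx kx eqx] fillings_extend(2)[OF Ty ky eqy]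
      by (metis diagram_inject)
    moreover have "Tx = Ty"
      using fillings_extend(3)[OF Tx kx eqx] fillings_extend(3)[OF Ty ky eqy] \<open>kx = ky\<close>
      by metis
    ultimately show "x = y" by (simp add: xy)
  next
    fix U assume "U \<in> ?g ` (SIGMA kap:?K. fillings Q n kap mu)"
    then obtain kap T where "T \<in> fillings Q n kap mu" "diagram kap \<subseteq> diagram lam"
      "Q (Suc n) (diagram lam - diagram kap)" "U = ?g (kap, T)" by (auto simp: strip_def)
    then show "U \<in> fillings Q (Suc n) lam mu" using fillings_extend(1)[of T Q n kap mu lam U] by simp
  next
    fix U assume U: "U \<in> fillings Q (Suc n) lam mu"
    then obtain kap where kap: "diagram kap = diagram mu \<union> {b \<in> diagram lam - diagram mu. U b \<le> n}"
      "diagram kap \<subseteq> diagram lam" "Q (Suc n) (diagram lam - diagram kap)"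
      "restrict U (diagram kap - diagram mu) \<in> fillings Q n kap mu"
      by (rule fillings_restrict)
    have UE: "U \<in> (diagram lam - diagram mu) \<rightarrow>\<^sub>E {1..Suc n}" and sub: "diagram mu \<subseteq> diagram lam"
      using U by (auto simp: fillings_def)
    have "?g (kap, restrict U (diagram kap - diagram mu)) = U"
    proof (rule ext)
      fix b
      consider "b \<in> diagram lam - diagram kap" | "b \<in> diagram kap - diagram mu"
        | "b \<notin> diagram lam - diagram mu" "b \<notin> diagram lam - diagram kap" by blast
      then show "?g (kap, restrict U (diagram kap - diagram mu)) b = U b"
      proof cases
        case 1
        then have "b \<in> diagram lam - diagram mu" "\<not> U b \<le> n" using kap(1) by auto
        then have "U b = Suc n" using PiE_mem[OF UE, of b] by simp
        then show ?thesis using 1 by simp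
      next
        case 2
        then show ?thesis by simp
      next
        case 3
        then have "U b = undefined" using UE by (auto intro: PiE_arb)
        moreover have "b \<notin> diagram kap - diagram mu" using 3 kap(2) by blast
        ultimately show ?thesis using 3 by auto
      qed
    qed
    moreover have "(kap, restrict U (diagram kap - diagram mu)) \<in> (SIGMA kap:?K. fillings Q n kap mu)"
      using kap by (simp add: strip_def)
    ultimately show "U \<in> ?g ` (SIGMA kap:?K. fillings Q n kap mu)"
      by (metis (no_types, lifting) image_eqI)
  qed
  then have "card (fillings Q (Suc n) lam mu) = card (SIGMA kap:?K. fillings Q n kap mu)"
    by (rule bij_betw_same_card[symmetric])
  also have "\<dots> = (\<Sum>kap | strip (Q (Suc n)) lam kap. card (fillings Q n kap mu))"
    by (rule card_SigmaI[OF finK]) (simp add: finite_fillings)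
  finally show ?thesis .
qed


section \<open>The local commutation relation\<close>

text \<open>
  Interpolates between the levels of a semistandard tableau (\<open>t = 0\<close>: horizontal strips with
  \<open>c\<close> boxes) and those of a reverse plane partition (\<open>t\<close> at least the number of rows:
  arbitrary skew shapes with \<open>c\<close> nonempty columns).
\<close>
definition partial_hstrip :: "nat \<Rightarrow> nat \<Rightarrow> (nat \<times> nat) set \<Rightarrow> bool" where
  "partial_hstrip t c D \<longleftrightarrow> card (snd ` D) = c
    \<and> (\<forall>i i' j. (i, j) \<in> D \<longrightarrow> (i', j) \<in> D \<longrightarrow> i < i' \<longrightarrow> i' \<le> Suc t)"

text \<open>Elegance allows the entry \<open>k\<close> in row \<open>i\<close> only if
  \<open>k \<le> i - 1\<close>; thus \<open>k\<close> is both the entry and the bound on the rows,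
  which \<open>fst\<close> counts from 1.\<close>

definition hstrip_below :: "nat \<Rightarrow> (nat \<times> nat) set \<Rightarrow> bool" where
  "hstrip_below k D \<longleftrightarrow> inj_on snd D \<and> (\<forall>b\<in>D. k < fst b)"

text \<open>A skew shape with two boxes in a column contains the boxes between them, so comparing
  adjacent rows suffices; the last box of the lower row is the critical one.\<close>

lemma no_repeated_column_iff:
  "(\<forall>i i' j. (i, j) \<in> diagram lam - diagram mu \<longrightarrow> (i', j) \<in> diagram lam - diagram mu
      \<longrightarrow> i < i' \<longrightarrow> i' \<le> Suc t)
    \<longleftrightarrow> (\<forall>i\<ge>t. row_len lam (Suc i) \<le> row_len mu i)" (is "?L \<longleftrightarrow> ?R")
proof
  assume L: ?L
  show ?R
  proof (intro allI impI leI notI)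
    fix i assume "t \<le> i" and less: "row_len mu i < row_len lam (Suc i)"
    let ?j = "row_len lam (Suc i)"
    have "(Suc i, ?j) \<in> diagram lam - diagram mu" "(Suc (Suc i), ?j) \<in> diagram lam - diagram mu"
      using less row_len_antimono[of i "Suc i" lam] row_len_antimono[of i "Suc i" mu]
      by (auto simp: mem_diagram)
    with L have "Suc (Suc i) \<le> Suc t" by blast
    with \<open>t \<le> i\<close> show False by simp
  qed
next
  assume R: ?R
  show ?L
  proof (intro allI impI leI notI)
    fix i i' j
    assume D: "(i, j) \<in> diagram lam - diagram mu" "(i', j) \<in> diagram lam - diagram mu"
      and "i < i'" and "Suc t < i'"
    \<comment> \<open>Diagram row \<open>i'\<close> has \<open>row_len\<close> index
      \<open>Suc r\<close>, so \<open>Suc t < i'\<close> becomes \<open>t \<le> r\<close>.\<close>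
    then obtain r where r: "i' = Suc (Suc r)" "t \<le> r" 
      by (metis Suc_le_D Suc_le_mono Suc_leI)
    have "row_len mu r \<le> row_len mu (i - 1)" using r \<open>i < i'\<close> by (intro row_len_antimono) simp
    moreover have "row_len mu (i - 1) < j" using D(1) by (auto simp: mem_diagram)
    moreover have "j \<le> row_len mu r" using D(2) R r by (auto simp: mem_diagram intro: le_trans)
    ultimately show False by simp
  qed
qed

text \<open>Rows start at 1, so \<open>i < i'\<close> contradicts \<open>i' \<le> Suc 0\<close>: the
  column condition for \<open>t = 0\<close> allows no repetition.\<close>

lemma inj_on_snd_iff:
  assumes "\<And>i j. (i, j) \<in> D \<Longrightarrow> 1 \<le> i"
  shows "inj_on snd D
    \<longleftrightarrow> (\<forall>i i' j. (i, j) \<in> D \<longrightarrow> (i', j) \<in> D \<longrightarrow> i < i' \<longrightarrow> i' \<le> Suc 0)" (is "?L \<longleftrightarrow> ?R")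
proof
  assume ?L
  then show ?R by (metis inj_onD less_irrefl prod.inject snd_conv)
next
  assume R: ?R
  have False if "(i, j) \<in> D" "(i', j) \<in> D" "i < i'" for i i' j
    using R assms[of i j] that by fastforce
  then show ?L by (intro inj_onI) (metis linorder_neqE_nat prod.collapse)
qed

lemma strip_hstrip_below_iff:
  "strip (hstrip_below k) lam mu \<longleftrightarrow>
    (\<forall>i. row_len mu i \<le> row_len lam i) \<and> (\<forall>i<k. row_len mu i = row_len lam i)
      \<and> (\<forall>i. row_len lam (Suc i) \<le> row_len mu i)"
proof -
  have rows: "(\<forall>b \<in> diagram lam - diagram mu. k < fst b) \<longleftrightarrow> (\<forall>i<k. row_len lam i \<le> row_len mu i)"
    (is "?L \<longleftrightarrow> ?R")
  proof
    assume L: ?L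
    show ?R
    proof (intro allI impI leI notI)
      fix i assume "i < k" and "row_len mu i < row_len lam i"
      then have "(Suc i, row_len lam i) \<in> diagram lam - diagram mu" by (auto simp: mem_diagram)
      with L have "k < fst (Suc i, row_len lam i)" by (rule bspec)
      with \<open>i < k\<close> show False by simp
    qed
  next
    assume R: ?R
    show ?L
    proof (clarsimp simp: mem_diagram, rule ccontr)
      fix i j
      assume a: "Suc 0 \<le> i" "j \<le> row_len lam (i - Suc 0)" "\<not> j \<le> row_len mu (i - Suc 0)" "\<not> k < i"
      then have "row_len lam (i - Suc 0) \<le> row_len mu (i - Suc 0)" using R by simp
      with a show False by simp
    qed
  qed
  have "inj_on snd (diagram lam - diagram mu) \<longleftrightarrow> (\<forall>i\<ge>0. row_len lam (Suc i) \<le> row_len mu i)"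
    unfolding no_repeated_column_iff[symmetric] by (rule inj_on_snd_iff) (simp add: mem_diagram)
  then show ?thesis
    unfolding strip_def hstrip_below_def diagram_subset_iff rows
    by (auto intro: antisym)
qed

text \<open>Row \<open>Suc i\<close> meets new columns only up to \<open>row_len mu i\<close>: its
  boxes further right lie below boxes of row \<open>i\<close> of the skew shape. Conversely, no
  earlier row meets columns up to \<open>row_len mu i\<close>, because the rows of \<open>mu\<close>
  decrease.\<close>

lemma card_columns:
  assumes sub: "diagram mu \<subseteq> diagram lam" and N: "row_len lam (Suc N) = 0"
  shows "card (snd ` (diagram lam - diagram mu)) =
    row_len lam 0 - row_len mu 0
      + (\<Sum>i<N. min (row_len lam (Suc i)) (row_len mu i) - row_len mu (Suc i))"
proof -
  let ?I = "\<lambda>i. {row_len mu i<..row_len lam i}"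
  have ms: "row_len mu (Suc i) \<le> row_len mu i" "row_len lam (Suc i) \<le> row_len lam i" for i
    by (simp_all add: row_len_antimono)
  have "card (\<Union>i\<le>n. ?I i) = row_len lam 0 - row_len mu 0
      + (\<Sum>i<n. min (row_len lam (Suc i)) (row_len mu i) - row_len mu (Suc i))" for n
  proof (induction n)
    case (Suc n)
    let ?J = "{row_len mu (Suc n)<..min (row_len lam (Suc n)) (row_len mu n)}"
    have "(\<Union>i\<le>Suc n. ?I i) = (\<Union>i\<le>n. ?I i) \<union> ?J"
    proof -
      have "?I (Suc n) \<subseteq> ?I n \<union> ?J" using ms[of n] by auto
      moreover have "?J \<subseteq> ?I (Suc n)" by auto
      moreover have "(\<Union>i\<le>Suc n. ?I i) = (\<Union>i\<le>n. ?I i) \<union> ?I (Suc n)"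
        by (simp add: atMost_Suc Un_commute)
      moreover have "?I n \<subseteq> (\<Union>i\<le>n. ?I i)" by blast
      ultimately show ?thesis by blast
    qed
    moreover have "(\<Union>i\<le>n. ?I i) \<inter> ?J = {}"
    proof -
      have "row_len mu n \<le> row_len mu i" if "i \<le> n" for i using that by (rule row_len_antimono)
      then show ?thesis by fastforce
    qed
    ultimately have "card (\<Union>i\<le>Suc n. ?I i) = card (\<Union>i\<le>n. ?I i) + card ?J"
      by (simp add: card_Un_disjoint)
    then show ?case using Suc.IH by simp
  qed simp
  moreover have "snd ` (diagram lam - diagram mu) = (\<Union>i\<le>N. ?I i)"
  proof (intro set_eqI iffI)
    fix j assume "j \<in> snd ` (diagram lam - diagram mu)"
    then obtain i where i: "row_len mu (i - 1) < j" "j \<le> row_len lam (i - 1)"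
      by (auto simp: mem_diagram not_le)
    have "i - 1 \<le> N"
    proof (rule ccontr)
      assume "\<not> i - 1 \<le> N"
      then have "row_len lam (i - 1) \<le> row_len lam (Suc N)" by (intro row_len_antimono) simp
      with i N show False by simp
    qed
    with i show "j \<in> (\<Union>i\<le>N. ?I i)" by auto
  next
    fix j assume "j \<in> (\<Union>i\<le>N. ?I i)"
    then obtain i where "row_len mu i < j" "j \<le> row_len lam i" by auto
    then have "(Suc i, j) \<in> diagram lam - diagram mu" by (auto simp: mem_diagram)
    then show "j \<in> snd ` (diagram lam - diagram mu)" by force
  qed
  ultimately show ?thesis by simp
qed

lemma strip_partial_hstrip_iff:
  "strip (partial_hstrip t c) lam mu \<longleftrightarrow>
    (\<forall>i. row_len mu i \<le> row_len lam i) \<and> (\<forall>i\<ge>t. row_len lam (Suc i) \<le> row_len mu i)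
      \<and> card (snd ` (diagram lam - diagram mu)) = c"
  unfolding strip_def partial_hstrip_def no_repeated_column_iff diagram_subset_iff
  by (simp only: conj_ac)

text \<open>Row lengths of a partition between \<open>l\<close> outside and \<open>v\<close> inside.
  The rows up to \<open>s\<close> are frozen to \<open>v\<close> on the left of the commutation
  relation and to \<open>l\<close> on the right, hence the parameter \<open>base\<close>.\<close>

definition between ::
  "nat \<Rightarrow> (nat \<Rightarrow> nat) \<Rightarrow> (nat \<Rightarrow> nat) \<Rightarrow> (nat \<Rightarrow> nat) \<Rightarrow> (nat \<Rightarrow> nat) \<Rightarrow> bool" where
  "between s l v base f \<longleftrightarrow> (\<forall>i\<le>s. f i = base i)
    \<and> (\<forall>i>s. max (v i) (l (Suc i)) \<le> f i \<and> f i \<le> min (l i) (v (i - 1)))"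

definition reflect ::
  "nat \<Rightarrow> (nat \<Rightarrow> nat) \<Rightarrow> (nat \<Rightarrow> nat) \<Rightarrow> (nat \<Rightarrow> nat) \<Rightarrow> (nat \<Rightarrow> nat) \<Rightarrow> nat \<Rightarrow> nat" where
  "reflect s l v base f i = (if i \<le> s then base i
    else max (v i) (l (Suc i)) + min (l i) (v (i - 1)) - f i)"

lemma between_reflect: "between s l v base f \<Longrightarrow> between s l v base' (reflect s l v base' f)"
  unfolding between_def reflect_def by (auto simp del: max.bounded_iff min.bounded_iff)

lemma reflect_reflect:
  assumes "between s l v base f"
  shows "reflect s l v base (reflect s l v base' f) = f"
proof
  fix i
  show "reflect s l v base (reflect s l v base' f) i = f i"
  proof (cases "i \<le> s")
    case False
    then have "f i \<le> min (l i) (v (i - 1))" using assms unfolding between_def by simp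
    \<comment> \<open>This bound makes the truncated subtraction in \<open>reflect\<close> exact, so
      that it can be undone.\<close>
    then have "f i \<le> max (v i) (l (Suc i)) + min (l i) (v (i - 1))" by (rule trans_le_add2)
    then show ?thesis using False by (simp add: reflect_def)
  qed (use assms in \<open>simp add: between_def reflect_def\<close>)
qed

text \<open>
  The rows \<open>i > s\<close> of the intermediate partitions on the two sides of the commutation relation
  range over the same intervals, with end points \<open>a i = max (v i) (l (Suc i))\<close> and
  \<open>b i = min (l i) (v (i - 1))\<close>, independently of the other rows. Reflecting all these
  intervals preserves the number of columns, by telescoping with
  \<open>a i + b (Suc i) = v i + l (Suc i)\<close>.
\<close>
lemma reflect_columns:
  assumes m: "between s l v v m" and m': "m' = reflect s l v l m"
    and N: "s < N" "l (Suc N) = 0" and vl: "v N \<le> l N"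
  shows "l 0 - m 0 + (\<Sum>i<N. min (l (Suc i)) (m i) - m (Suc i))
    = m' 0 - v 0 + (\<Sum>i<N. min (m' (Suc i)) (v i) - v (Suc i))"
proof -
  have low: "m i = v i" "m' i = l i" if "i \<le> s" for i
    using m that by (simp_all add: between_def m' reflect_def)
  have bnd: "max (v i) (l (Suc i)) \<le> m i" "m i \<le> min (l i) (v (i - 1))"
    "max (v i) (l (Suc i)) \<le> m' i" "m' i \<le> min (l i) (v (i - 1))" if "s < i" for i
    using m between_reflect[OF m, of l] that unfolding between_def m' by blast+
  have refl: "m i + m' i = max (v i) (l (Suc i)) + min (l i) (v (i - 1))" if "s < i" for i
    using trans_le_add2[OF bnd(2)[OF that], of "max (v i) (l (Suc i))"] that
    unfolding m' reflect_def by simp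
  \<comment> \<open>Both summands are \<open>min (l (Suc i)) (v i) - v (Suc i)\<close>, since here
    \<open>m\<close> agrees with \<open>v\<close> and \<open>m'\<close> with
    \<open>l\<close>.\<close>
  have low_sum: "(\<Sum>i<s. min (l (Suc i)) (m i) - m (Suc i)) = (\<Sum>i<s. min (m' (Suc i)) (v i) - v (Suc i))"
    by (intro sum.cong) (simp_all add: low)
  \<comment> \<open>The partial sums differ by the boundary term
    \<open>max (v n) (l (Suc n)) - v n\<close>, which vanishes at \<open>n = N\<close> because
    \<open>l (Suc N) = 0\<close>.\<close>
  have "(\<Sum>i<n. min (l (Suc i)) (m i) - m (Suc i)) + max (v n) (l (Suc n))
    = (\<Sum>i<n. min (m' (Suc i)) (v i) - v (Suc i)) + v n" if "Suc s \<le> n" for n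
    using that
  proof (induction n rule: dec_induct)
    case base
    have "m' (Suc s) \<le> v s" "v (Suc s) \<le> m' (Suc s)" using bnd[of "Suc s"] by simp_all
    then show ?case using low_sum low[of s] refl[of "Suc s"] bnd[of "Suc s"]
      by (simp add: min_absorb1)
  next
    case (step n)
    have "m' (Suc n) \<le> v n" "v (Suc n) \<le> m' (Suc n)" using bnd[of "Suc n"] step by simp_all
    moreover have "l (Suc n) \<le> m n" using bnd(1)[of n] step by simp
    moreover have "m (Suc n) + m' (Suc n) = max (v (Suc n)) (l (Suc (Suc n))) + min (l (Suc n)) (v n)"
      "m (Suc n) \<le> l (Suc n)"
      using refl[of "Suc n"] bnd(2)[of "Suc n"] step by simp_all
    moreover have "max (v n) (l (Suc n)) + min (l (Suc n)) (v n) = v n + l (Suc n)" by simp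
    ultimately show ?case using step.IH by (simp add: min_absorb1)
  qed
  from this[of N] N vl show ?thesis by (simp add: low)
qed

text \<open>With \<open>l\<close> and \<open>v\<close> for the row lengths of \<open>lam\<close> and
  \<open>nu\<close>, the interval of row \<open>Suc i\<close> ends at
  \<open>min (l (Suc i)) (v i)\<close>, which is at most the start
  \<open>max (v i) (l (Suc i))\<close> of the interval of row \<open>i\<close>. So independent
  choices always give a partition.\<close>

lemma row_len_inv_between:
  assumes f: "between s (row_len lam) (row_len nu) base f"
    and base: "base = row_len lam \<or> base = row_len nu"
  shows "row_len (inv row_len f) = f"
proof -
  have "f (Suc i) \<le> f i" for i
  proof (cases "i < s")
    case True
    then show ?thesis using f base row_len_antimono[of i "Suc i"] by (auto simp: between_def)
  next
    case False
    then have "s < Suc i" by simp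
    then have "f (Suc i) \<le> min (row_len lam (Suc i)) (row_len nu (Suc i - 1))"
      using f unfolding between_def by blast
    then have "f (Suc i) \<le> min (row_len lam (Suc i)) (row_len nu i)" by simp
    moreover have "min (row_len lam (Suc i)) (row_len nu i) \<le> f i"
    proof (cases "i = s")
      case True
      then have "f i = base i" using f by (simp add: between_def)
      then show ?thesis using base row_len_antimono[of i "Suc i" lam] by auto
    next
      case False
      then have "max (row_len nu i) (row_len lam (Suc i)) \<le> f i"
        using f \<open>\<not> i < s\<close> by (simp add: between_def)
      then show ?thesis by (simp add: min_le_iff_disj)
    qed
    ultimately show ?thesis by (rule le_trans)
  qed
  then have "antimono f" by (simp add: antimono_iff_le_Suc)
  moreover have "f i = 0" if "Suc s + length (parts lam) \<le> i" for i
  proof -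
    have "f i \<le> min (row_len lam i) (row_len nu (i - 1))" using f that by (simp add: between_def)
    then show ?thesis using that by (simp add: row_len_eq_0)
  qed
  ultimately have "f \<in> range row_len" using ex_partition_row_len by (metis rangeI)
  then show ?thesis by (rule f_inv_into_f)
qed

text \<open>In rows beyond \<open>s\<close> the partial strip supplies the bounds by
  \<open>lam\<close> and the horizontal strip those by \<open>nu\<close>.\<close>

lemma strip_partial_hstrip_below_iff:
  "strip (partial_hstrip (Suc s) c) lam mu \<and> strip (hstrip_below (Suc s)) mu nu \<longleftrightarrow>
    (\<forall>i. row_len nu i \<le> row_len lam i)
    \<and> between s (row_len lam) (row_len nu) (row_len nu) (row_len mu)
    \<and> card (snd ` (diagram lam - diagram mu)) = c" (is "?L \<longleftrightarrow> ?R")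
proof
  assume ?L
  then have h: "\<And>i. row_len mu i \<le> row_len lam i" "\<And>i. s < i \<Longrightarrow> row_len lam (Suc i) \<le> row_len mu i"
    "\<And>i. row_len nu i \<le> row_len mu i" "\<And>i. i \<le> s \<Longrightarrow> row_len nu i = row_len mu i"
    "\<And>i. row_len mu (Suc i) \<le> row_len nu i" "card (snd ` (diagram lam - diagram mu)) = c"
    by (auto simp: strip_partial_hstrip_iff strip_hstrip_below_iff less_Suc_eq_le Suc_le_eq)
  have "row_len mu i \<le> row_len nu (i - 1)" if "s < i" for i using h(5)[of "i - 1"] that by simp
  then show ?R using h(6) h(1-4) le_trans[OF h(3) h(1)] by (auto simp: between_def)
next
  assume R: ?R
  then have low: "\<And>i. i \<le> s \<Longrightarrow> row_len mu i = row_len nu i"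
    and up: "\<And>i. s < i \<Longrightarrow> row_len nu i \<le> row_len mu i" "\<And>i. s < i \<Longrightarrow> row_len lam (Suc i) \<le> row_len mu i"
      "\<And>i. s < i \<Longrightarrow> row_len mu i \<le> row_len lam i" "\<And>i. s < i \<Longrightarrow> row_len mu i \<le> row_len nu (i - 1)"
    by (auto simp: between_def)
  have "row_len mu (Suc i) \<le> row_len nu i" for i
    using low[of "Suc i"] up(4)[of "Suc i"] row_len_antimono[of i "Suc i" nu] by (cases "i < s") auto
  moreover have "row_len mu i \<le> row_len lam i" "row_len nu i \<le> row_len mu i" for i
    using low[of i] up[of i] R by (cases "i \<le> s"; simp)+
  ultimately show ?L using R low up
    by (auto simp: strip_partial_hstrip_iff strip_hstrip_below_iff less_Suc_eq_le Suc_le_eq)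
qed

text \<open>The column condition now bounds \<open>row_len mu (Suc i)\<close> for
  \<open>s \<le> i\<close>, whereas in the other product it bounds \<open>row_len mu i\<close> for
  \<open>Suc s \<le> i\<close>. Both concern the rows beyond \<open>s\<close>, which is why the
  parameter drops by one.\<close>

lemma strip_below_partial_hstrip_iff:
  "strip (hstrip_below (Suc s)) lam mu \<and> strip (partial_hstrip s c) mu nu \<longleftrightarrow>
    (\<forall>i. row_len nu i \<le> row_len lam i)
    \<and> between s (row_len lam) (row_len nu) (row_len lam) (row_len mu)
    \<and> card (snd ` (diagram mu - diagram nu)) = c" (is "?L \<longleftrightarrow> ?R")
proof
  assume ?L
  then have h: "\<And>i. row_len mu i \<le> row_len lam i" "\<And>i. row_len lam (Suc i) \<le> row_len mu i"
    "\<And>i. row_len nu i \<le> row_len mu i" "\<And>i. i \<le> s \<Longrightarrow> row_len mu i = row_len lam i"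
    "\<And>i. s \<le> i \<Longrightarrow> row_len mu (Suc i) \<le> row_len nu i" "card (snd ` (diagram mu - diagram nu)) = c"
    by (auto simp: strip_partial_hstrip_iff strip_hstrip_below_iff less_Suc_eq_le)
  have "row_len mu i \<le> row_len nu (i - 1)" if "s < i" for i using h(5)[of "i - 1"] that by simp
  then show ?R using h(6) h(1-4) le_trans[OF h(3) h(1)] by (auto simp: between_def)
next
  assume R: ?R
  then have low: "\<And>i. i \<le> s \<Longrightarrow> row_len mu i = row_len lam i"
    and up: "\<And>i. s < i \<Longrightarrow> row_len nu i \<le> row_len mu i" "\<And>i. s < i \<Longrightarrow> row_len lam (Suc i) \<le> row_len mu i"
      "\<And>i. s < i \<Longrightarrow> row_len mu i \<le> row_len lam i" "\<And>i. s < i \<Longrightarrow> row_len mu i \<le> row_len nu (i - 1)"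
    by (auto simp: between_def)
  have "row_len mu (Suc i) \<le> row_len nu i" if "s \<le> i" for i using up(4)[of "Suc i"] that by simp
  moreover have "row_len mu i \<le> row_len lam i" "row_len nu i \<le> row_len mu i"
    "row_len lam (Suc i) \<le> row_len mu i" for i
    using low[of i] up[of i] R row_len_antimono[of i "Suc i" lam] by (cases "i \<le> s"; simp)+
  ultimately show ?L using R low
    by (auto simp: strip_partial_hstrip_iff strip_hstrip_below_iff less_Suc_eq_le)
qed

text \<open>One matrix entry of \<open>S (s + 1) H (s + 1) = H (s + 1) S s\<close>:
  \<open>reflect\<close> with exchanged base is a bijection of intermediate partitions and keeps the
  number of columns by \<open>reflect_columns\<close>.\<close>

lemma card_strips_commute:
  "card {mu. strip (partial_hstrip (Suc s) c) lam mu \<and> strip (hstrip_below (Suc s)) mu nu}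
    = card {mu. strip (hstrip_below (Suc s)) lam mu \<and> strip (partial_hstrip s c) mu nu}"
proof (cases "\<forall>i. row_len nu i \<le> row_len lam i")
  case False
  then show ?thesis unfolding strip_partial_hstrip_below_iff strip_below_partial_hstrip_iff
    by (simp only: simp_thms)
next
  case True
  let ?l = "row_len lam" and ?v = "row_len nu"
  let ?f = "\<lambda>base mu. inv row_len (reflect s ?l ?v base (row_len mu))"
  define N where "N = Suc s + length (parts lam)"
  have f: "row_len (?f base mu) = reflect s ?l ?v base (row_len mu)"
    if "between s ?l ?v base' (row_len mu)" "base = ?l \<or> base = ?v" for base base' mu
    using row_len_inv_between[OF between_reflect[OF that(1)] that(2)] .
  have ff: "?f base (?f base' mu) = mu"
    if "between s ?l ?v base (row_len mu)" "base' = ?l \<or> base' = ?v" for base base' mu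
    unfolding f[OF that] reflect_reflect[OF that(1)] by (rule inv_f_f) (simp add: inj_def row_len_inject)
  have cols: "card (snd ` (diagram lam - diagram mu)) = card (snd ` (diagram (?f ?l mu) - diagram nu))"
    if mu: "between s ?l ?v ?v (row_len mu)" for mu
  proof -
    let ?k = "?f ?l mu"
    have k: "row_len ?k = reflect s ?l ?v ?l (row_len mu)" by (rule f[OF mu]) simp
    then have bk: "between s ?l ?v ?l (row_len ?k)" using between_reflect[OF mu] by simp
    have "row_len mu i \<le> ?l i" "row_len ?k i \<le> ?l i" "?v i \<le> row_len ?k i" for i
      using True mu bk by (cases "i \<le> s"; auto simp: between_def)+
    then have sub: "diagram mu \<subseteq> diagram lam" "diagram nu \<subseteq> diagram ?k"
      and "row_len ?k (Suc N) \<le> ?l (Suc N)"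
      by (simp_all add: diagram_subset_iff)
    moreover have lN: "?l (Suc N) = 0" by (simp add: row_len_eq_0 N_def)
    ultimately have kN: "row_len ?k (Suc N) = 0" by simp
    show ?thesis
      unfolding card_columns[OF sub(1) lN] card_columns[OF sub(2) kN]
      by (rule reflect_columns[OF mu k _ lN]) (simp_all add: N_def True)
  qed
  have "bij_betw (?f ?l)
    {mu. between s ?l ?v ?v (row_len mu) \<and> card (snd ` (diagram lam - diagram mu)) = c}
    {mu. between s ?l ?v ?l (row_len mu) \<and> card (snd ` (diagram mu - diagram nu)) = c}"
  proof (rule bij_betw_byWitness[where f' = "?f ?v"])
    show "?f ?l ` {mu. between s ?l ?v ?v (row_len mu) \<and> card (snd ` (diagram lam - diagram mu)) = c}
      \<subseteq> {mu. between s ?l ?v ?l (row_len mu) \<and> card (snd ` (diagram mu - diagram nu)) = c}"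
      using f between_reflect cols by auto
    show "?f ?v ` {mu. between s ?l ?v ?l (row_len mu) \<and> card (snd ` (diagram mu - diagram nu)) = c}
      \<subseteq> {mu. between s ?l ?v ?v (row_len mu) \<and> card (snd ` (diagram lam - diagram mu)) = c}"
    proof (rule image_subsetI, rule CollectI)
      fix mu
      assume "mu \<in> {mu. between s ?l ?v ?l (row_len mu) \<and> card (snd ` (diagram mu - diagram nu)) = c}"
      then have mu: "between s ?l ?v ?l (row_len mu)" "card (snd ` (diagram mu - diagram nu)) = c" by auto
      have "row_len (?f ?v mu) = reflect s ?l ?v ?v (row_len mu)" by (rule f[OF mu(1)]) simp
      then have b: "between s ?l ?v ?v (row_len (?f ?v mu))" using between_reflect[OF mu(1)] by simp
      have "?f ?l (?f ?v mu) = mu" by (rule ff[OF mu(1)]) simp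
      then show "between s ?l ?v ?v (row_len (?f ?v mu))
        \<and> card (snd ` (diagram lam - diagram (?f ?v mu))) = c"
        using cols[OF b] b mu(2) by simp
    qed
  qed (use ff in auto)
  then show ?thesis
    unfolding strip_partial_hstrip_below_iff strip_below_partial_hstrip_iff using True
    by (simp add: bij_betw_same_card)
qed

section \<open>Expansion into chains of horizontal strips\<close>

lemma strip_subparts: "strip P lam mu \<Longrightarrow> lam \<in> subparts p \<Longrightarrow> mu \<in> subparts p"
  by (auto simp: strip_def subparts_def)

lemma card_fillings_Suc_subparts:
  assumes "lam \<in> subparts p"
  shows "card (fillings Q (Suc n) lam mu) =
    (\<Sum>kap\<in>subparts p. of_bool (strip (Q (Suc n)) lam kap) * card (fillings Q n kap mu))"
proof -
  have "card (fillings Q (Suc n) lam mu) =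
      (\<Sum>kap | strip (Q (Suc n)) lam kap. of_bool (strip (Q (Suc n)) lam kap) * card (fillings Q n kap mu))"
    unfolding card_fillings_Suc by (intro sum.cong) auto
  also have "\<dots> = (\<Sum>kap\<in>subparts p. of_bool (strip (Q (Suc n)) lam kap) * card (fillings Q n kap mu))"
    using strip_subparts[OF _ assms]
    by (intro sum.mono_neutral_left finite_subparts) auto
  finally show ?thesis .
qed

lemma sum_of_bool_strips:
  assumes "lam \<in> subparts p"
  shows "(\<Sum>mu\<in>subparts p. of_bool (strip P lam mu) * of_bool (strip Q mu nu))
    = card {mu. strip P lam mu \<and> strip Q mu nu}"
proof -
  have "{mu. strip P lam mu \<and> strip Q mu nu} = subparts p \<inter> {mu. strip P lam mu \<and> strip Q mu nu}"
    using strip_subparts[OF _ assms] by auto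
  then show ?thesis
    by (simp add: finite_subparts flip: of_bool_conj)
qed

text \<open>Induction with \<open>F (s + 1) = H (s + 1) F s\<close>: passing each factor lowers the
  parameter of \<open>S\<close> by one, until \<open>S 0\<close> is left.\<close>

lemma fillings_hstrip_commute:
  assumes "lam \<in> subparts p" "nu \<in> subparts p"
  shows "(\<Sum>mu\<in>subparts p. of_bool (strip (partial_hstrip t c) lam mu) * card (fillings hstrip_below t mu nu))
    = (\<Sum>mu\<in>subparts p. card (fillings hstrip_below t lam mu) * of_bool (strip (partial_hstrip 0 c) mu nu))"
  using assms(1)
proof (induction t arbitrary: lam)
  case 0
  have l: "(\<Sum>mu\<in>subparts p. of_bool (P mu) * of_bool (mu = nu)) = (of_bool (P nu) :: nat)" for P
  proof -
    have "(\<Sum>mu\<in>subparts p. of_bool (P mu) * of_bool (mu = nu)) = (\<Sum>mu\<in>{nu}. of_bool (P mu) :: nat)"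
      using assms(2) by (intro sum.mono_neutral_cong_right finite_subparts) auto
    then show ?thesis by simp
  qed
  have r: "(\<Sum>mu\<in>subparts p. of_bool (lam = mu) * of_bool (P mu)) = (of_bool (P lam) :: nat)" for P
  proof -
    have "(\<Sum>mu\<in>subparts p. of_bool (lam = mu) * of_bool (P mu)) = (\<Sum>mu\<in>{lam}. of_bool (P mu) :: nat)"
      using 0 by (intro sum.mono_neutral_cong_right finite_subparts) auto
    then show ?thesis by simp
  qed
  show ?case unfolding card_fillings_0 l r ..
next
  case (Suc s)
  let ?X = "subparts p" and ?F = "\<lambda>t lam mu. card (fillings hstrip_below t lam mu)"
  let ?V = "\<lambda>t lam mu. of_bool (strip (partial_hstrip t c) lam mu) :: nat"
  let ?H = "\<lambda>lam mu. of_bool (strip (hstrip_below (Suc s)) lam mu) :: nat"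
  have "(\<Sum>mu\<in>?X. ?V (Suc s) lam mu * ?F (Suc s) mu nu)
      = (\<Sum>mu\<in>?X. \<Sum>rho\<in>?X. ?V (Suc s) lam mu * (?H mu rho * ?F s rho nu))"
    by (intro sum.cong refl) (simp only: card_fillings_Suc_subparts sum_distrib_left)
  also have "\<dots> = (\<Sum>rho\<in>?X. (\<Sum>mu\<in>?X. ?V (Suc s) lam mu * ?H mu rho) * ?F s rho nu)"
    by (subst sum.swap) (simp only: sum_distrib_right mult.assoc)
  also have "\<dots> = (\<Sum>rho\<in>?X. (\<Sum>mu\<in>?X. ?H lam mu * ?V s mu rho) * ?F s rho nu)"
    unfolding sum_of_bool_strips[OF Suc.prems] card_strips_commute ..
  also have "\<dots> = (\<Sum>mu\<in>?X. ?H lam mu * (\<Sum>rho\<in>?X. ?V s mu rho * ?F s rho nu))"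
    by (simp only: sum_distrib_right sum_distrib_left mult.assoc) (rule sum.swap)
  also have "\<dots> = (\<Sum>mu\<in>?X. ?H lam mu * (\<Sum>rho\<in>?X. ?F s mu rho * ?V 0 rho nu))"
    by (intro sum.cong refl) (simp only: Suc.IH)
  also have "\<dots> = (\<Sum>rho\<in>?X. (\<Sum>mu\<in>?X. ?H lam mu * ?F s mu rho) * ?V 0 rho nu)"
    by (simp only: sum_distrib_right sum_distrib_left mult.assoc) (rule sum.swap)
  also have "\<dots> = (\<Sum>rho\<in>?X. ?F (Suc s) lam rho * ?V 0 rho nu)"
    unfolding card_fillings_Suc_subparts[OF Suc.prems] ..
  finally show ?case .
qed

definition empty_partition :: partition where
  "empty_partition = Partition []"

lemma diagram_empty_partition: "diagram empty_partition = {}"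
proof -
  have "parts empty_partition = []" unfolding empty_partition_def by (rule Partition_inverse) simp
  then show ?thesis by (simp add: diagram_def)
qed

text \<open>In a nonempty shape the box \<open>(1, 1)\<close> would carry an entry
  \<open>k \<ge> 1\<close> that is allowed only below row \<open>k\<close>. Hence \<open>F t\<close>
  fixes the unit vector at the empty partition.\<close>

lemma card_fillings_hstrip_empty:
  "card (fillings hstrip_below t lam empty_partition) = of_bool (lam = empty_partition)"
proof (cases "lam = empty_partition")
  case True
  have "fillings hstrip_below t lam empty_partition = {\<lambda>_. undefined}"
    unfolding True
    by (auto simp: fillings_def row_weak_def col_weak_def diagram_empty_partition hstrip_below_def)
  then show ?thesis using True by simp
next
  case False
  then have "diagram lam \<noteq> {}" using diagram_inject diagram_empty_partition by metis
  then obtain i j where "(i, j) \<in> diagram lam" by auto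
  then have one: "(1, 1) \<in> diagram lam"
    using diagram_downward[of i j lam 1 1] by (auto simp: mem_diagram)
  have "fillings hstrip_below t lam empty_partition = {}"
  proof (intro equals0I)
    fix T assume T: "T \<in> fillings hstrip_below t lam empty_partition"
    then have k: "T (1, 1) \<in> {1..t}" using one by (auto simp: fillings_def diagram_empty_partition)
    have "hstrip_below (T (1, 1)) {b \<in> diagram lam. T b = T (1, 1)}"
      using T k by (auto simp: fillings_def diagram_empty_partition)
    then show False using one k by (auto simp: hstrip_below_def)
  qed
  then show ?thesis using False by simp
qed

text \<open>Induction on the number of variables: each contributes a factor \<open>S t\<close> on
  the left and \<open>S 0\<close> on the right, and \<open>F t\<close> is moved through by
  \<open>fillings_hstrip_commute\<close>.\<close>

lemma card_fillings_partial_expand: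
  assumes "lam \<in> subparts p"
  shows "card (fillings (\<lambda>k. partial_hstrip t (m k)) n lam empty_partition)
    = (\<Sum>mu\<in>subparts p. card (fillings hstrip_below t lam mu)
        * card (fillings (\<lambda>k. partial_hstrip 0 (m k)) n mu empty_partition))"
  using assms
proof (induction n arbitrary: lam)
  case 0
  have e: "empty_partition \<in> subparts p" by (simp add: subparts_def diagram_empty_partition)
  have "(\<Sum>mu\<in>subparts p. card (fillings hstrip_below t lam mu) * of_bool (mu = empty_partition))
    = (\<Sum>mu\<in>{empty_partition}. card (fillings hstrip_below t lam mu))"
    using e by (intro sum.mono_neutral_cong_right finite_subparts) auto
  then show ?case by (simp add: card_fillings_0 card_fillings_hstrip_empty)
next
  case (Suc n)
  let ?X = "subparts p" and ?F = "\<lambda>lam mu. card (fillings hstrip_below t lam mu)"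
  let ?V = "\<lambda>t lam mu. of_bool (strip (partial_hstrip t (m (Suc n))) lam mu) :: nat"
  let ?R = "\<lambda>t n mu. card (fillings (\<lambda>k. partial_hstrip t (m k)) n mu empty_partition)"
  have "?R t (Suc n) lam = (\<Sum>mu\<in>?X. ?V t lam mu * ?R t n mu)"
    by (rule card_fillings_Suc_subparts[OF Suc.prems])
  also have "\<dots> = (\<Sum>mu\<in>?X. ?V t lam mu * (\<Sum>nu\<in>?X. ?F mu nu * ?R 0 n nu))"
    by (intro sum.cong refl) (simp only: Suc.IH)
  also have "\<dots> = (\<Sum>nu\<in>?X. (\<Sum>mu\<in>?X. ?V t lam mu * ?F mu nu) * ?R 0 n nu)"
    by (simp only: sum_distrib_right sum_distrib_left mult.assoc) (rule sum.swap)
  also have "\<dots> = (\<Sum>nu\<in>?X. (\<Sum>mu\<in>?X. ?F lam mu * ?V 0 mu nu) * ?R 0 n nu)"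
    by (intro sum.cong refl) (simp only: fillings_hstrip_commute[OF Suc.prems])
  also have "\<dots> = (\<Sum>mu\<in>?X. ?F lam mu * (\<Sum>nu\<in>?X. ?V 0 mu nu * ?R 0 n nu))"
    by (simp only: sum_distrib_right sum_distrib_left mult.assoc) (rule sum.swap)
  also have "\<dots> = (\<Sum>mu\<in>?X. ?F lam mu * ?R 0 (Suc n) mu)"
    by (intro sum.cong refl) (simp only: card_fillings_Suc_subparts)
  finally show ?case .
qed

section \<open>Tableaux as fillings with prescribed levels\<close>

text \<open>Expresses strictness through level sets, so that semistandard and elegant fillings
  become instances of \<open>fillings\<close>.\<close>

lemma col_strict_iff:
  assumes T: "T \<in> D \<rightarrow>\<^sub>E {1..n}"
  shows "col_strict D T \<longleftrightarrow> col_weak D T \<and> (\<forall>k\<in>{1..n}. inj_on snd {b \<in> D. T b = k})"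
proof (intro iffI conjI ballI)
  assume s: "col_strict D T"
  then show "col_weak D T"
    unfolding col_strict_def col_weak_def by (metis le_eq_less_or_eq)
  fix k
  show "inj_on snd {b \<in> D. T b = k}"
  proof (rule inj_onI, clarify)
    fix i j i' j' assume a: "(i, j) \<in> D" "(i', j') \<in> D" "k = T (i, j)" "T (i', j') = T (i, j)"
      "snd (i, j) = snd (i', j')"
    then show "i = i' \<and> j = j'"
      using s unfolding col_strict_def by (metis less_irrefl linorder_neqE_nat snd_conv)
  qed
next
  assume w: "col_weak D T \<and> (\<forall>k\<in>{1..n}. inj_on snd {b \<in> D. T b = k})"
  show "col_strict D T"
    unfolding col_strict_def
  proof (intro allI impI)
    fix i i' j assume a: "(i, j) \<in> D" "(i', j) \<in> D" "i < i'"
    have "T (i, j) \<in> {1..n}" using T a(1) by (rule PiE_mem)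
    then have "inj_on snd {b \<in> D. T b = T (i, j)}" using w by blast
    then have "T (i, j) \<noteq> T (i', j)" using a by (auto dest!: inj_onD[of _ _ "(i, j)" "(i', j)"])
    moreover have "T (i, j) \<le> T (i', j)" using w a unfolding col_weak_def by simp
    ultimately show "T (i, j) < T (i', j)" by simp
  qed
qed

text \<open>Entries in row \<open>i\<close> are smaller than \<open>i\<close>, so the number of rows
  of \<open>lam\<close> bounds all of them.\<close>

lemma elegant_fillings_eq:
  assumes "diagram mu \<subseteq> diagram lam"
  shows "elegant_fillings lam mu = fillings hstrip_below (length (parts lam)) lam mu"
    (is "?L = fillings _ ?n lam mu")
proof (intro set_eqI)
  fix T
  let ?D = "diagram lam - diagram mu"
  have row: "i \<le> ?n" if "(i, j) \<in> ?D" for i j using that by (auto simp: diagram_def)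
  have lev: "T \<in> ?D \<rightarrow>\<^sub>E {1..} \<and> (\<forall>(i, j) \<in> ?D. T (i, j) \<in> {1..i - 1})
    \<longleftrightarrow> T \<in> ?D \<rightarrow>\<^sub>E {1..?n} \<and> (\<forall>k\<in>{1..?n}. \<forall>b\<in>{b \<in> ?D. T b = k}. k < fst b)" (is "?A \<longleftrightarrow> ?B")
  proof
    assume A: ?A
    have b: "T b \<in> {1..?n} \<and> T b < fst b" if "b \<in> ?D" for b
    proof -
      obtain i j where "b = (i, j)" by fastforce
      then have "T b \<in> {1..fst b - 1}" using A that by fastforce
      moreover have "fst b \<le> ?n" using row[of "fst b" "snd b"] that by simp
      ultimately show ?thesis by auto
    qed
    have "T \<in> ?D \<rightarrow>\<^sub>E {1..?n}" using A b by (intro PiE_I) (auto intro: PiE_arb)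
    then show ?B using b by blast
  next
    assume B: ?B
    have "T b \<in> {1..}" "T b \<in> {1..fst b - 1}" if "b \<in> ?D" for b
    proof -
      have "T b \<in> {1..?n}" using B that by (blast intro: PiE_mem)
      moreover from this have "T b < fst b" using B that by blast
      ultimately show "T b \<in> {1..}" "T b \<in> {1..fst b - 1}" by auto
    qed
    moreover have "T b = undefined" if "b \<notin> ?D" for b using B that by (blast intro: PiE_arb)
    ultimately show ?A by (fastforce intro!: PiE_I)
  qed
  have "T \<in> ?L \<longleftrightarrow> row_weak ?D T \<and> col_strict ?D T \<and> ?B"
    unfolding lev[symmetric] elegant_fillings_def semistandard_def by blast
  also have "\<dots> \<longleftrightarrow> T \<in> fillings hstrip_below ?n lam mu"
    unfolding fillings_def hstrip_below_def mem_Collect_eq ball_conj_distrib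
    using assms col_strict_iff[of T ?D ?n] by blast
  finally show "T \<in> ?L \<longleftrightarrow> T \<in> fillings hstrip_below ?n lam mu" .
qed

lemma partial_hstrip_0_iff:
  assumes "\<And>i j. (i, j) \<in> D \<Longrightarrow> 1 \<le> i"
  shows "partial_hstrip 0 c D \<longleftrightarrow> inj_on snd D \<and> card D = c"
proof -
  have "partial_hstrip 0 c D \<longleftrightarrow> card (snd ` D) = c \<and> inj_on snd D"
    unfolding partial_hstrip_def by (subst inj_on_snd_iff) (use assms in auto)
  then show ?thesis using card_image[of snd D] by auto
qed

text \<open>Reduces to the variables with index in \<open>{1..n}\<close>: any other entry would give
  a nonempty level of weight zero. Here \<open>h\<close> stands for the number of boxes or of
  columns.\<close>

lemma card_level_eq_weight:
  assumes keys: "Poly_Mapping.keys m \<subseteq> {1..n}" and T: "T \<in> D \<rightarrow>\<^sub>E {1..}"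
    and h: "\<And>A. A \<subseteq> D \<Longrightarrow> h A = 0 \<longleftrightarrow> A = {}"
  shows "(\<forall>k. h {b \<in> D. T b = k} = Poly_Mapping.lookup m k) \<longleftrightarrow>
    T \<in> D \<rightarrow>\<^sub>E {1..n} \<and> (\<forall>k\<in>{1..n}. h {b \<in> D. T b = k} = Poly_Mapping.lookup m k)"
proof
  assume L: "\<forall>k. h {b \<in> D. T b = k} = Poly_Mapping.lookup m k"
  have "T b \<in> {1..n}" if "b \<in> D" for b
  proof -
    have "h {b' \<in> D. T b' = T b} \<noteq> 0" using h[of "{b' \<in> D. T b' = T b}"] that by blast
    then show ?thesis using L keys by (auto simp: in_keys_iff)
  qed
  then have "T \<in> D \<rightarrow>\<^sub>E {1..n}" using T by (auto simp: PiE_iff)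
  with L show "T \<in> D \<rightarrow>\<^sub>E {1..n} \<and> (\<forall>k\<in>{1..n}. h {b \<in> D. T b = k} = Poly_Mapping.lookup m k)" by blast
next
  assume R: "T \<in> D \<rightarrow>\<^sub>E {1..n} \<and> (\<forall>k\<in>{1..n}. h {b \<in> D. T b = k} = Poly_Mapping.lookup m k)"
  show "\<forall>k. h {b \<in> D. T b = k} = Poly_Mapping.lookup m k"
  proof
    fix k
    show "h {b \<in> D. T b = k} = Poly_Mapping.lookup m k"
    proof (cases "k \<in> {1..n}")
      case False
      have "{b \<in> D. T b = k} = {}" using R False by (auto simp: PiE_iff)
      then have "h {b \<in> D. T b = k} = 0" using h by blast
      moreover have "Poly_Mapping.lookup m k = 0" using False keys by (auto simp: in_keys_iff)
      ultimately show ?thesis by simp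
    qed (use R in blast)
  qed
qed

lemma rpps_weight_eq_fillings:
  assumes keys: "Poly_Mapping.keys m \<subseteq> {1..n}"
  shows "{T \<in> rpps lam. column_weight (diagram lam) T = m}
    = fillings (\<lambda>k. partial_hstrip (length (parts lam)) (Poly_Mapping.lookup m k)) n lam empty_partition"
proof (intro set_eqI)
  fix T
  let ?D = "diagram lam" and ?t = "length (parts lam)"
  have num: "num_columns ?D T k = card (snd ` {b \<in> ?D. T b = k})" for k
  proof -
    have "{j. \<exists>i. (i, j) \<in> ?D \<and> T (i, j) = k} = snd ` {b \<in> ?D. T b = k}" by force
    then show ?thesis by (simp add: num_columns_def)
  qed
  have w: "column_weight ?D T = m \<longleftrightarrow> (\<forall>k. card (snd ` {b \<in> ?D. T b = k}) = Poly_Mapping.lookup m k)"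
    by (simp add: poly_mapping_eq_iff fun_eq_iff lookup_column_weight finite_diagram num)
  \<comment> \<open>Rows of \<open>lam\<close> have index at most \<open>?t\<close>, so repeated
    columns are unrestricted.\<close>
  have v: "partial_hstrip ?t c {b \<in> ?D. T b = k} \<longleftrightarrow> card (snd ` {b \<in> ?D. T b = k}) = c" for c k
    by (auto simp: partial_hstrip_def diagram_def)
  have z: "card (snd ` A) = 0 \<longleftrightarrow> A = {}" if "A \<subseteq> ?D" for A
    using finite_subset[OF that finite_diagram] by simp
  have mono: "T \<in> ?D \<rightarrow>\<^sub>E {1..n} \<Longrightarrow> T \<in> ?D \<rightarrow>\<^sub>E {1..}" by (auto simp: PiE_iff)
  have "T \<in> {T \<in> rpps lam. column_weight ?D T = m} \<longleftrightarrow>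
      T \<in> ?D \<rightarrow>\<^sub>E {1..} \<and> row_weak ?D T \<and> col_weak ?D T
        \<and> (\<forall>k. card (snd ` {b \<in> ?D. T b = k}) = Poly_Mapping.lookup m k)"
    unfolding rpps_def mem_Collect_eq w by blast
  also have "\<dots> \<longleftrightarrow> T \<in> ?D \<rightarrow>\<^sub>E {1..n} \<and> row_weak ?D T \<and> col_weak ?D T
        \<and> (\<forall>k\<in>{1..n}. card (snd ` {b \<in> ?D. T b = k}) = Poly_Mapping.lookup m k)"
    using card_level_eq_weight[OF keys, of T ?D "\<lambda>A. card (snd ` A)"] z mono by blast
  also have "\<dots> \<longleftrightarrow> T \<in> fillings (\<lambda>k. partial_hstrip ?t (Poly_Mapping.lookup m k)) n lam empty_partition"
    by (simp add: fillings_def diagram_empty_partition v)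
  finally show "T \<in> {T \<in> rpps lam. column_weight ?D T = m} \<longleftrightarrow>
    T \<in> fillings (\<lambda>k. partial_hstrip ?t (Poly_Mapping.lookup m k)) n lam empty_partition" .
qed

lemma semistandard_weight_eq_fillings:
  assumes keys: "Poly_Mapping.keys m \<subseteq> {1..n}"
  shows "{T \<in> semistandard (diagram mu). box_weight (diagram mu) T = m}
    = fillings (\<lambda>k. partial_hstrip 0 (Poly_Mapping.lookup m k)) n mu empty_partition"
proof (intro set_eqI)
  fix T
  let ?D = "diagram mu"
  have w: "box_weight ?D T = m \<longleftrightarrow> (\<forall>k. card {b \<in> ?D. T b = k} = Poly_Mapping.lookup m k)"
    by (simp add: poly_mapping_eq_iff fun_eq_iff lookup_box_weight finite_diagram)
  have v: "partial_hstrip 0 c {b \<in> ?D. T b = k}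
      \<longleftrightarrow> inj_on snd {b \<in> ?D. T b = k} \<and> card {b \<in> ?D. T b = k} = c" for c k
    by (rule partial_hstrip_0_iff) (auto simp: mem_diagram)
  have z: "card A = 0 \<longleftrightarrow> A = {}" if "A \<subseteq> ?D" for A
    using finite_subset[OF that finite_diagram] by simp
  have mono: "T \<in> ?D \<rightarrow>\<^sub>E {1..n} \<Longrightarrow> T \<in> ?D \<rightarrow>\<^sub>E {1..}" by (auto simp: PiE_iff)
  have "T \<in> {T \<in> semistandard ?D. box_weight ?D T = m} \<longleftrightarrow>
      T \<in> ?D \<rightarrow>\<^sub>E {1..} \<and> row_weak ?D T \<and> col_strict ?D T
        \<and> (\<forall>k. card {b \<in> ?D. T b = k} = Poly_Mapping.lookup m k)"
    unfolding semistandard_def mem_Collect_eq w by blast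
  also have "\<dots> \<longleftrightarrow> T \<in> ?D \<rightarrow>\<^sub>E {1..n} \<and> row_weak ?D T \<and> col_strict ?D T
        \<and> (\<forall>k\<in>{1..n}. card {b \<in> ?D. T b = k} = Poly_Mapping.lookup m k)"
    using card_level_eq_weight[OF keys, of T ?D card] z mono by blast
  also have "\<dots> \<longleftrightarrow> T \<in> ?D \<rightarrow>\<^sub>E {1..n} \<and> row_weak ?D T \<and> col_weak ?D T
        \<and> (\<forall>k\<in>{1..n}. inj_on snd {b \<in> ?D. T b = k} \<and> card {b \<in> ?D. T b = k} = Poly_Mapping.lookup m k)"
    using col_strict_iff[of T ?D n] by blast
  also have "\<dots> \<longleftrightarrow> T \<in> fillings (\<lambda>k. partial_hstrip 0 (Poly_Mapping.lookup m k)) n mu empty_partition"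
    by (simp add: fillings_def diagram_empty_partition v)
  finally show "T \<in> {T \<in> semistandard ?D. box_weight ?D T = m} \<longleftrightarrow>
    T \<in> fillings (\<lambda>k. partial_hstrip 0 (Poly_Mapping.lookup m k)) n mu empty_partition" .
qed

lemma sum_any_elegant_number:
  "Sum_any (\<lambda>mu. int (elegant_number lam mu) * c mu)
    = (\<Sum>mu\<in>subparts lam. int (card (fillings hstrip_below (length (parts lam)) lam mu)) * c mu)"
proof -
  have "Sum_any (\<lambda>mu. int (elegant_number lam mu) * c mu)
      = (\<Sum>mu\<in>subparts lam. int (elegant_number lam mu) * c mu)"
    by (rule Sum_any.expand_superset[OF finite_subparts])
      (auto simp: elegant_number_def subparts_def split: if_splits)
  also have "\<dots> = (\<Sum>mu\<in>subparts lam. int (card (fillings hstrip_below (length (parts lam)) lam mu)) * c mu)"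
    by (intro sum.cong refl) (simp add: elegant_number_def subparts_def elegant_fillings_eq)
  finally show ?thesis .
qed

theorem theorem9p8:
  fixes lam :: partition
  shows "dual_grothendieck lam = (\<lambda>m. Sum_any (\<lambda>mu. int (elegant_number lam mu) * schur mu m))"
proof
  fix m :: "nat \<Rightarrow>\<^sub>0 nat"
  show "dual_grothendieck lam m = Sum_any (\<lambda>mu. int (elegant_number lam mu) * schur mu m)"
  proof (cases "0 \<in> Poly_Mapping.keys m")
    \<comment> \<open>Entries are positive, so the variable with index 0 never occurs and both
      coefficients vanish.\<close>
    case True
    have "column_weight (diagram lam) T \<noteq> m" if "T \<in> rpps lam" for T
    proof -
      have none: "{j. \<exists>i. (i, j) \<in> diagram lam \<and> T (i, j) = 0} = {}"
        using that by (fastforce simp: rpps_def PiE_iff)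
      have "Poly_Mapping.lookup (column_weight (diagram lam) T) 0 = 0"
        unfolding lookup_column_weight[OF finite_diagram] num_columns_def none by simp
      then show ?thesis using True by (auto simp: in_keys_iff)
    qed
    moreover have "box_weight (diagram mu) T \<noteq> m" if "T \<in> semistandard (diagram mu)" for mu T
    proof -
      have none: "{b \<in> diagram mu. T b = 0} = {}"
        using that by (fastforce simp: semistandard_def PiE_iff)
      have "Poly_Mapping.lookup (box_weight (diagram mu) T) 0 = 0"
        unfolding lookup_box_weight[OF finite_diagram] none by simp
      then show ?thesis using True by (auto simp: in_keys_iff)
    qed
    ultimately have "{T \<in> rpps lam. column_weight (diagram lam) T = m} = {}"
      "\<And>mu. {T \<in> semistandard (diagram mu). box_weight (diagram mu) T = m} = {}"
      by blast+
    then have "dual_grothendieck lam m = 0" "\<And>mu. schur mu m = 0"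
      unfolding dual_grothendieck_def schur_def gen_series_def by (simp_all only: card.empty of_nat_0)
    then show ?thesis by simp
  next
    case False
    obtain n where n: "Poly_Mapping.keys m \<subseteq> {..n}"
      using finite_nat_set_iff_bounded_le[of "Poly_Mapping.keys m"] by auto
    have keys: "Poly_Mapping.keys m \<subseteq> {1..n}"
    proof
      fix k assume "k \<in> Poly_Mapping.keys m"
      moreover from this have "k \<noteq> 0" using False by metis
      ultimately show "k \<in> {1..n}" using n by auto
    qed
    have "lam \<in> subparts lam" by (simp add: subparts_def)
    \<comment> \<open>The choice of \<open>t\<close> serves twice: it makes the levels of reverse
      plane partitions unrestricted and admits all entries of elegant fillings.\<close>
    from card_fillings_partial_expand[OF this, of "length (parts lam)" "Poly_Mapping.lookup m" n]
    show ?thesis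
      unfolding sum_any_elegant_number dual_grothendieck_def schur_def gen_series_def
        rpps_weight_eq_fillings[OF keys] semistandard_weight_eq_fillings[OF keys] by simp
  qed
qed

end
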